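(* Let $Q=(V,E)$ be a finite simple connected graph with $|V(Q)|=n$ and $|E(Q)|=m$. Let $r,s$ be positive integers and let $p,q$ be integers with $1\le p\le r$ and $1\le q\le s$. Then the $(r,s)$-generalised transformation graph $Q_{rs}^{x(p)\,y(q)\,-}$ satisfies $$\begin{aligned} M_1\big(Q_{rs}^{x(p)\,y(q)\,-}\big)=\;&\big\{p(1-s)^2+(r-p)(s+1)^2+2q(nr-2r-2)+2(q-s)(m+r(n-2)+1)\big\}M_1(Q)\\ &+2s\,M_2(Q)+s\,F(Q)+(r-p)\big\{n(n+sm-1)^2-4m(n+sm-1)(s+1)\big\}\\ &+psm^2\big(ns+4(1-s)\big)+mq(nr-2r-2)^2+m(s-q)\big(m+r(n-2)+1\big)^2 . \end{aligned}$$
   Context: For a finite simple graph $H$, $d_H(\alpha)$ denotes the degree of the vertex $\alpha$ in $H$. The first Zagreb index is $M_1(H)=\sum_{\alpha\in V(H)}d_H(\alpha)^2$, the second Zagreb index is $M_2(H)=\sum_{\alpha\beta\in E(H)}d_H(\alpha)d_H(\beta)$, and the forgotten index is $F(H)=\sum_{\alpha\in V(H)}d_H(\alpha)^3$. All arithmetic is in the integers. Two distinct edges of $Q$ are called adjacent if they have a common end vertex; a vertex and an edge are incident if the vertex is an end vertex of the edge. $(r,s)$-generalised transformation graphs: let $Q=(V,E)$ be a finite simple connected graph and $r,s$ positive integers. Take $r$ disjoint copies $V_1,\dots,V_r$ of $V(Q)$ and $s$ disjoint copies $E_1,\dots,E_s$ of $E(Q)$. Given sign vectors $x=(x_1,\dots,x_r)$,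 $y=(y_1,\dots,y_s)$ and $z=(z_{gh})_{1\le g\le r,\,1\le h\le s}$ with all entries in $\{+,-\}$, the graph $Q_{rs}^{xyz}$ is the simple graph with vertex set $\big(\bigcup_{g=1}^r V_g\big)\cup\big(\bigcup_{h=1}^s E_h\big)$ in which two distinct vertices $\alpha,\beta$ are adjacent if and only if one of the following holds: (i) $\alpha,\beta\in V_g$ for some $g$, and (as vertices of $Q$) they are adjacent in $Q$ if $x_g=+$, respectively not adjacent in $Q$ if $x_g=-$; (ii) $\alpha,\beta\in E_h$ for some $h$, and (as edges of $Q$) they are adjacent in $Q$ if $y_h=+$, respectively not adjacent in $Q$ if $y_h=-$; (iii) $\alpha\in V_g$ and $\beta\in E_h$ (or vice versa) for some $g,h$, and (as a vertex and an edge of $Q$) they are incident in $Q$ if $z_{gh}=+$, respectively not incident in $Q$ if $z_{gh}=-$. In particular there are no edges between different copies $V_g,V_{g'}$ or between different copies $E_h,E_{h'}$. For $1\le p\le r$, $x(p)$ is the vector with $x_g=+$ for $1\le g\le p$ and $x_g=-$ for $p<g\le r$. For $1\le q\le s$, $y(q)$ is the vector with $y_h=+$ for $1\le h\le q$ and $y_h=-$ for $q<h\le s$. The graph $Q_{rs}^{x(p)\,y(q)\,-}$ is $Q_{rs}^{xyz}$ with $x=x(p)$, $y=y(q)$ and $z_{gh}=-$ for all $g,h$. *)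

theory Defs
  imports Main
begin

record 'a graph =
  verts :: "'a set"
  edges :: "'a set set"

definition simple_graph :: "'a graph \<Rightarrow> bool" where
  "simple_graph G \<longleftrightarrow> finite (verts G) \<and> edges G \<subseteq> {e. e \<subseteq> verts G \<and> card e = 2}"

definition adj :: "'a graph \<Rightarrow> 'a \<Rightarrow> 'a \<Rightarrow> bool" where
  "adj G u v \<longleftrightarrow> {u, v} \<in> edges G"

(* As usual, a connected graph has at least one vertex. *)
definition connected_graph :: "'a graph \<Rightarrow> bool" where
  "connected_graph G \<longleftrightarrow> verts G \<noteq> {} \<and> (\<forall>u\<in>verts G. \<forall>v\<in>verts G. (adj G)\<^sup>*\<^sup>* u v)"

definition degree :: "'a graph \<Rightarrow> 'a \<Rightarrow> nat" where
  "degree G v = card {e \<in> edges G. v \<in> e}"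

definition first_zagreb :: "'a graph \<Rightarrow> int" where
  "first_zagreb G = (\<Sum>v\<in>verts G. int (degree G v) ^ 2)"

(* An edge is the two-element set of its end vertices, so the inner product is
   the product of the two end degrees. *)
definition second_zagreb :: "'a graph \<Rightarrow> int" where
  "second_zagreb G = (\<Sum>e\<in>edges G. \<Prod>v\<in>e. int (degree G v))"

definition forgotten_index :: "'a graph \<Rightarrow> int" where
  "forgotten_index G = (\<Sum>v\<in>verts G. int (degree G v) ^ 3)"

definition edges_adjacent :: "'a set \<Rightarrow> 'a set \<Rightarrow> bool" where
  "edges_adjacent e f \<longleftrightarrow> e \<noteq> f \<and> e \<inter> f \<noteq> {}"

datatype sign = Plus | Minus

fun signed :: "sign \<Rightarrow> bool \<Rightarrow> bool" where
  "signed Plus P \<longleftrightarrow> P"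
| "signed Minus P \<longleftrightarrow> \<not> P"

(* The first component is the number of the copy that the vertex lies in. *)
datatype 'a tvertex = VCopy nat 'a | ECopy nat "'a set"

fun trans_adj ::
  "'a graph \<Rightarrow> (nat \<Rightarrow> sign) \<Rightarrow> (nat \<Rightarrow> sign) \<Rightarrow> (nat \<Rightarrow> nat \<Rightarrow> sign)
    \<Rightarrow> 'a tvertex \<Rightarrow> 'a tvertex \<Rightarrow> bool" where
  "trans_adj Q x y z (VCopy g u) (VCopy g' v) \<longleftrightarrow> g = g' \<and> signed (x g) (adj Q u v)"
| "trans_adj Q x y z (ECopy h e) (ECopy h' f) \<longleftrightarrow> h = h' \<and> signed (y h) (edges_adjacent e f)"
| "trans_adj Q x y z (VCopy g u) (ECopy h e) \<longleftrightarrow> signed (z g h) (u \<in> e)"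
| "trans_adj Q x y z (ECopy h e) (VCopy g u) \<longleftrightarrow> signed (z g h) (u \<in> e)"

definition trans_verts :: "'a graph \<Rightarrow> nat \<Rightarrow> nat \<Rightarrow> 'a tvertex set" where
  "trans_verts Q r s =
     {VCopy g v | g v. g \<in> {1..r} \<and> v \<in> verts Q} \<union>
     {ECopy h e | h e. h \<in> {1..s} \<and> e \<in> edges Q}"

(* Sign vectors are functions on nat; only their values at indices in {1..r}
   and {1..s} affect the graph. *)
definition trans_graph ::
  "'a graph \<Rightarrow> nat \<Rightarrow> nat \<Rightarrow> (nat \<Rightarrow> sign) \<Rightarrow> (nat \<Rightarrow> sign) \<Rightarrow> (nat \<Rightarrow> nat \<Rightarrow> sign)
    \<Rightarrow> 'a tvertex graph" where
  "trans_graph Q r s x y z =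
     \<lparr> verts = trans_verts Q r s,
       edges = {{\<alpha>, \<beta>} | \<alpha> \<beta>. \<alpha> \<in> trans_verts Q r s \<and> \<beta> \<in> trans_verts Q r s
                  \<and> \<alpha> \<noteq> \<beta> \<and> trans_adj Q x y z \<alpha> \<beta>} \<rparr>"

definition plus_upto :: "nat \<Rightarrow> nat \<Rightarrow> sign" where
  "plus_upto p g = (if g \<le> p then Plus else Minus)"

lemma simple_graph_trans_graph:
  assumes "simple_graph Q"
  shows "simple_graph (trans_graph Q r s x y z)"
proof -
  have V: "finite (verts Q)" and E: "finite (edges Q)"
    using assms finite_subset[of "edges Q" "Pow (verts Q)"]
    by (auto simp: simple_graph_def)
  have "trans_verts Q r s =
      case_prod VCopy ` ({1..r} \<times> verts Q) \<union> case_prod ECopy ` ({1..s} \<times> edges Q)"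
    by (auto simp: trans_verts_def)
  with V E have "finite (trans_verts Q r s)" by simp
  then show ?thesis by (auto simp: simple_graph_def trans_graph_def)
qed

lemma trans_adj_sym: "trans_adj Q x y z \<alpha> \<beta> \<longleftrightarrow> trans_adj Q x y z \<beta> \<alpha>"
  by (cases \<alpha>; cases \<beta>) (auto simp: adj_def edges_adjacent_def insert_commute Int_commute eq_commute)

end

theory Submission
  imports Defs
begin

text \<open>
  A vertex copy of \<open>v\<close> has degree \<open>d(v) + s(m - d(v))\<close> or \<open>n - 1 - d(v) + s(m - d(v))\<close>, and an
  edge copy of \<open>e = uv\<close> has degree \<open>D - 2 + r(n - 2)\<close> or \<open>m + 1 - D + r(n - 2)\<close>, where
  \<open>D = d(u) + d(v)\<close>. Summing the squares, only \<open>\<Sum> d\<close>, \<open>\<Sum> d\<^sup>2\<close>, \<open>\<Sum> D\<close> and \<open>\<Sum> D\<^sup>2\<close> occur. Counting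
  incident pairs in two ways gives \<open>\<Sum> d = 2m\<close>, \<open>\<Sum> D = M\<^sub>1\<close> and \<open>\<Sum> D\<^sup>2 = F + 2 M\<^sub>2\<close>.
\<close>

section \<open>Counting neighbours of a vertex and edges adjacent to an edge\<close>

lemma finite_verts: "simple_graph G \<Longrightarrow> finite (verts G)"
  by (simp add: simple_graph_def)

lemma finite_edges: "simple_graph G \<Longrightarrow> finite (edges G)"
  unfolding simple_graph_def using finite_subset[of "edges G" "Pow (verts G)"] by auto

lemma simple_graph_edgeD:
  assumes "simple_graph G" "e \<in> edges G"
  shows "e \<subseteq> verts G" "card e = 2"
  using assms by (auto simp: simple_graph_def)

lemma not_adj_self: "simple_graph G \<Longrightarrow> \<not> adj G v v"
  by (auto simp: simple_graph_def adj_def)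

text \<open>Sending a neighbour \<open>u\<close> to \<open>{v, u}\<close> is a bijection onto the
  edges at \<open>v\<close>. This form suits the transformation graph, which is described by an
  adjacency relation.\<close>

lemma degree_eq_card_neighbours:
  assumes "simple_graph G"
  shows "degree G v = card {u \<in> verts G. adj G v u}"
proof -
  have "{e \<in> edges G. v \<in> e} = (\<lambda>u. {v, u}) ` {u \<in> verts G. adj G v u}"
  proof (intro equalityI subsetI)
    fix e assume e: "e \<in> {e \<in> edges G. v \<in> e}"
    with simple_graph_edgeD[OF assms, of e] obtain u where "e = {v, u}" "u \<in> verts G"
      by (auto simp: card_2_iff insert_commute)
    with e show "e \<in> (\<lambda>u. {v, u}) ` {u \<in> verts G. adj G v u}"
      by (auto simp: adj_def)
  qed (auto simp: adj_def)
  moreover have "inj_on (\<lambda>u. {v, u}) A" for A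
    by (auto simp: inj_on_def doubleton_eq_iff)
  ultimately show ?thesis
    by (simp add: degree_def card_image)
qed

lemma card_non_neighbours:
  assumes "simple_graph G" "v \<in> verts G"
  shows "int (card {u \<in> verts G. u \<noteq> v \<and> \<not> adj G v u})
    = int (card (verts G)) - 1 - int (degree G v)"
proof -
  let ?A = "{u \<in> verts G. u \<noteq> v \<and> \<not> adj G v u}" and ?B = "{u \<in> verts G. adj G v u}"
  have fin: "finite (verts G)" using assms(1) by (rule finite_verts)
  have "verts G = insert v (?A \<union> ?B)"
    using assms by auto
  then have "card (verts G) = card (insert v (?A \<union> ?B))"
    by simp
  \<comment> \<open>\<open>v\<close> lies outside \<open>?A\<close> by definition and outside
    \<open>?B\<close> because there are no loops.\<close>
  also have "\<dots> = Suc (card ?A + card ?B)"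
    using fin not_adj_self[OF assms(1)] by (subst card_insert_disjoint) (auto intro: card_Un_disjoint)
  finally show ?thesis
    by (simp add: degree_eq_card_neighbours[OF assms(1)])
qed

lemma card_Collect_not:
  assumes "finite A"
  shows "int (card {x \<in> A. \<not> P x}) = int (card A) - int (card {x \<in> A. P x})"
proof -
  have "card A = card ({x \<in> A. P x} \<union> {x \<in> A. \<not> P x})"
    by (rule arg_cong[of _ _ card]) auto
  also have "\<dots> = card {x \<in> A. P x} + card {x \<in> A. \<not> P x}"
    using assms by (intro card_Un_disjoint) auto
  finally show ?thesis by simp
qed

text \<open>Inclusion-exclusion on the edges at the two ends of \<open>e\<close>: together they are
  \<open>e\<close> and the edges adjacent to it, and only \<open>e\<close> is counted twice. Hence
  the degree sum exceeds the number of adjacent edges by 2.\<close>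

lemma card_adjacent_edges:
  assumes "simple_graph G" "e \<in> edges G"
  shows "int (card {f \<in> edges G. edges_adjacent e f}) = (\<Sum>v\<in>e. int (degree G v)) - 2"
proof -
  obtain u v where e: "e = {u, v}" "u \<noteq> v"
    using simple_graph_edgeD(2)[OF assms] by (auto simp: card_2_iff)
  let ?U = "{f \<in> edges G. u \<in> f}" and ?V = "{f \<in> edges G. v \<in> f}"
  have fin: "finite (edges G)" using assms(1) by (rule finite_edges)
  have int: "?U \<inter> ?V = {e}"
  proof -
    \<comment> \<open>A two-element set containing both ends of \<open>e\<close> is
      \<open>e\<close>: there are no multiple edges.\<close>
    have "f = e" if "f \<in> edges G" "u \<in> f" "v \<in> f" for f
      using simple_graph_edgeD(2)[OF assms(1) that(1)] that e by (auto simp: card_2_iff)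
    moreover have "e \<in> ?U \<inter> ?V"
      using assms(2) e(1) by simp
    ultimately show ?thesis by blast
  qed
  have "?U \<union> ?V = insert e {f \<in> edges G. edges_adjacent e f}"
    using assms(2) unfolding edges_adjacent_def e(1) by blast
  then have "card (?U \<union> ?V) = Suc (card {f \<in> edges G. edges_adjacent e f})"
    using fin by (simp add: edges_adjacent_def)
  moreover have "card ?U + card ?V = card (?U \<union> ?V) + card (?U \<inter> ?V)"
    using fin by (intro card_Un_Int) auto
  ultimately show ?thesis
    using e int by (simp add: degree_def)
qed

text \<open>An edge is not adjacent to itself, so the complement of the \<open>D - 2\<close>
  adjacent edges still contains \<open>e\<close>; removing it leaves
  \<open>m - (D - 2) - 1\<close>.\<close>

lemma card_nonadjacent_edges:
  assumes "simple_graph G" "e \<in> edges G"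
  shows "int (card {f \<in> edges G. f \<noteq> e \<and> \<not> edges_adjacent e f})
    = int (card (edges G)) + 1 - (\<Sum>v\<in>e. int (degree G v))"
proof -
  have "{f \<in> edges G. f \<noteq> e \<and> \<not> edges_adjacent e f}
      = {f \<in> edges G. \<not> edges_adjacent e f} - {e}" by auto
  moreover have "e \<in> {f \<in> edges G. \<not> edges_adjacent e f}"
    using assms(2) by (simp add: edges_adjacent_def)
  moreover have "finite {f \<in> edges G. \<not> edges_adjacent e f}"
    using finite_edges[OF assms(1)] by simp
  ultimately have "Suc (card {f \<in> edges G. f \<noteq> e \<and> \<not> edges_adjacent e f})
      = card {f \<in> edges G. \<not> edges_adjacent e f}"
    by (simp only: card_Suc_Diff1)
  then show ?thesis
    using card_Collect_not[OF finite_edges[OF assms(1)], of "edges_adjacent e"]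
      card_adjacent_edges[OF assms] by linarith
qed

section \<open>Double counting of incident vertex-edge pairs\<close>

lemma sum_edges_sum_ends:
  fixes g :: "'a \<Rightarrow> int"
  assumes "simple_graph G"
  shows "(\<Sum>e\<in>edges G. \<Sum>v\<in>e. g v) = (\<Sum>v\<in>verts G. int (degree G v) * g v)"
proof -
  \<comment> \<open>Edges lie inside \<open>verts G\<close>, so the inner sum may range over the
    incident vertices there; after the swap each \<open>g v\<close> occurs once per edge at
    \<open>v\<close>.\<close>
  have "(\<Sum>e\<in>edges G. \<Sum>v\<in>e. g v) = (\<Sum>e\<in>edges G. \<Sum>v | v \<in> verts G \<and> v \<in> e. g v)"
    using simple_graph_edgeD(1)[OF assms] by (intro sum.cong) auto
  also have "\<dots> = (\<Sum>v\<in>verts G. \<Sum>e | e \<in> edges G \<and> v \<in> e. g v)"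
    using finite_edges[OF assms] finite_verts[OF assms] by (rule sum.swap_restrict)
  finally show ?thesis by (simp add: degree_def)
qed

text \<open>The handshake lemma, from the constant weight 1.\<close>

lemma sum_degree: "simple_graph G \<Longrightarrow> (\<Sum>v\<in>verts G. int (degree G v)) = 2 * int (card (edges G))"
  using sum_edges_sum_ends[of G "\<lambda>_. 1"] simple_graph_edgeD(2)[of G] by simp

lemma sum_edge_degree_sum:
  "simple_graph G \<Longrightarrow> (\<Sum>e\<in>edges G. \<Sum>v\<in>e. int (degree G v)) = first_zagreb G"
  by (simp add: sum_edges_sum_ends first_zagreb_def power2_eq_square)

text \<open>In the square of \<open>d(u) + d(v)\<close>, the pure squares sum to the forgotten index
  by double counting with weight \<open>d^2\<close>, and the products sum to the second Zagreb
  index.\<close>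

lemma sum_edge_degree_sum_squared:
  assumes "simple_graph G"
  shows "(\<Sum>e\<in>edges G. (\<Sum>v\<in>e. int (degree G v))\<^sup>2) = forgotten_index G + 2 * second_zagreb G"
proof -
  have "(\<Sum>v\<in>e. int (degree G v))\<^sup>2
      = (\<Sum>v\<in>e. (int (degree G v))\<^sup>2) + 2 * (\<Prod>v\<in>e. int (degree G v))" if "e \<in> edges G" for e
    using simple_graph_edgeD(2)[OF assms that] by (auto simp: card_2_iff power2_sum)
  then show ?thesis
    using sum_edges_sum_ends[OF assms, of "\<lambda>v. (int (degree G v))\<^sup>2"]
    by (simp add: sum.distrib sum_distrib_left forgotten_index_def second_zagreb_def
        power2_eq_square power3_eq_cube mult.assoc)
qed

section \<open>Degrees in the transformation graph\<close>

lemma verts_trans_graph: "verts (trans_graph Q r s x y z) = trans_verts Q r s"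
  by (simp add: trans_graph_def)

text \<open>An edge is an unordered pair, so it yields \<open>trans_adj\<close> in one of two
  orders; symmetry makes them agree.\<close>

lemma adj_trans_graph:
  "adj (trans_graph Q r s x y z) \<alpha> \<beta> \<longleftrightarrow>
    \<alpha> \<in> trans_verts Q r s \<and> \<beta> \<in> trans_verts Q r s \<and> \<alpha> \<noteq> \<beta> \<and> trans_adj Q x y z \<alpha> \<beta>"
  unfolding adj_def trans_graph_def
  by (auto simp: doubleton_eq_iff trans_adj_sym)

text \<open>Meant for \<open>VCopy\<close> and \<open>ECopy\<close>, which are injective in index
  and element jointly, so that distinct copies contribute separately.\<close>

lemma card_case_prod_image_Sigma:
  assumes "finite I" "\<And>i. i \<in> I \<Longrightarrow> finite (A i)" "\<And>i j a b. f i a = f j b \<Longrightarrow> i = j \<and> a = b"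
  shows "card (case_prod f ` (SIGMA i:I. A i)) = (\<Sum>i\<in>I. card (A i))"
proof -
  have "inj_on (case_prod f) (SIGMA i:I. A i)"
    using assms(3) by (auto simp: inj_on_def)
  then show ?thesis
    using assms by (simp add: card_image)
qed

text \<open>Neighbours of a vertex copy lie in the same copy or in one of the edge copies. The
  condition \<open>u \<noteq> v\<close> matters for sign \<open>Minus\<close>, where
  \<open>v\<close> itself would otherwise be counted.\<close>

lemma degree_trans_graph_VCopy:
  assumes Q: "simple_graph Q" and g: "g \<in> {1..r}" and v: "v \<in> verts Q"
  shows "degree (trans_graph Q r s x y z) (VCopy g v)
    = card {u \<in> verts Q. u \<noteq> v \<and> signed (x g) (adj Q v u)}
      + (\<Sum>h=1..s. card {e \<in> edges Q. signed (z g h) (v \<in> e)})"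
proof -
  let ?T = "trans_graph Q r s x y z"
  let ?A = "VCopy g ` {u \<in> verts Q. u \<noteq> v \<and> signed (x g) (adj Q v u)}"
  let ?B = "case_prod ECopy ` (SIGMA h:{1..s}. {e \<in> edges Q. signed (z g h) (v \<in> e)})"
  have "{\<beta> \<in> verts ?T. adj ?T (VCopy g v) \<beta>} = ?A \<union> ?B"
    using g v by (auto simp: verts_trans_graph adj_trans_graph trans_verts_def image_iff)
  moreover have "card (?A \<union> ?B) = card ?A + card ?B"
    using finite_verts[OF Q] finite_edges[OF Q] by (intro card_Un_disjoint) auto
  moreover have "card ?B = (\<Sum>h=1..s. card {e \<in> edges Q. signed (z g h) (v \<in> e)})"
    using finite_edges[OF Q] by (intro card_case_prod_image_Sigma) auto
  ultimately show ?thesis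
    by (simp add: degree_eq_card_neighbours[OF simple_graph_trans_graph[OF Q]] card_image inj_on_def)
qed

lemma degree_trans_graph_ECopy:
  assumes Q: "simple_graph Q" and h: "h \<in> {1..s}" and e: "e \<in> edges Q"
  shows "degree (trans_graph Q r s x y z) (ECopy h e)
    = card {f \<in> edges Q. f \<noteq> e \<and> signed (y h) (edges_adjacent e f)}
      + (\<Sum>g=1..r. card {v \<in> verts Q. signed (z g h) (v \<in> e)})"
proof -
  let ?T = "trans_graph Q r s x y z"
  let ?A = "ECopy h ` {f \<in> edges Q. f \<noteq> e \<and> signed (y h) (edges_adjacent e f)}"
  let ?B = "case_prod VCopy ` (SIGMA g:{1..r}. {v \<in> verts Q. signed (z g h) (v \<in> e)})"
  have "{\<beta> \<in> verts ?T. adj ?T (ECopy h e) \<beta>} = ?A \<union> ?B"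
    using h e by (auto simp: verts_trans_graph adj_trans_graph trans_verts_def image_iff)
  moreover have "card (?A \<union> ?B) = card ?A + card ?B"
    using finite_verts[OF Q] finite_edges[OF Q] by (intro card_Un_disjoint) auto
  moreover have "card ?B = (\<Sum>g=1..r. card {v \<in> verts Q. signed (z g h) (v \<in> e)})"
    using finite_verts[OF Q] by (intro card_case_prod_image_Sigma) auto
  ultimately show ?thesis
    by (simp add: degree_eq_card_neighbours[OF simple_graph_trans_graph[OF Q]] card_image inj_on_def)
qed

text \<open>Each of the \<open>s\<close> edge copies contributes the edges missing \<open>v\<close>.
  Both cases are arranged as affine expressions in \<open>degree Q v\<close>.\<close>

lemma degree_VCopy_Minus:
  assumes Q: "simple_graph Q" and g: "g \<in> {1..r}" and v: "v \<in> verts Q"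
  shows "int (degree (trans_graph Q r s x y (\<lambda>g h. Minus)) (VCopy g v))
    = (case x g of
        Plus \<Rightarrow> int s * int (card (edges Q)) + (1 - int s) * int (degree Q v)
      | Minus \<Rightarrow> (int (card (verts Q)) + int s * int (card (edges Q)) - 1)
          - (int s + 1) * int (degree Q v))"
proof -
  have "{u \<in> verts Q. u \<noteq> v \<and> adj Q v u} = {u \<in> verts Q. adj Q v u}"
    using not_adj_self[OF Q] by auto
  then have plus: "card {u \<in> verts Q. u \<noteq> v \<and> adj Q v u} = degree Q v"
    by (simp add: degree_eq_card_neighbours[OF Q])
  have minus: "int (card {e \<in> edges Q. v \<notin> e}) = int (card (edges Q)) - int (degree Q v)"
    using card_Collect_not[OF finite_edges[OF Q]] by (simp add: degree_def)
  show ?thesis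
    by (simp add: degree_trans_graph_VCopy[OF assms] plus minus card_non_neighbours[OF Q v]
        algebra_simps split: sign.split)
qed

text \<open>Each of the \<open>r\<close> vertex copies contributes the \<open>n - 2\<close> vertices
  off \<open>e\<close>; the rest comes from the edges in the same copy.\<close>

lemma degree_ECopy_Minus:
  assumes Q: "simple_graph Q" and h: "h \<in> {1..s}" and e: "e \<in> edges Q"
  shows "int (degree (trans_graph Q r s x y (\<lambda>g h. Minus)) (ECopy h e))
    = (case y h of
        Plus \<Rightarrow> (\<Sum>v\<in>e. int (degree Q v)) + (int (card (verts Q)) * int r - 2 * int r - 2)
      | Minus \<Rightarrow> (int (card (edges Q)) + int r * (int (card (verts Q)) - 2) + 1)
          - (\<Sum>v\<in>e. int (degree Q v)))"
proof -
  have plus: "{f \<in> edges Q. f \<noteq> e \<and> edges_adjacent e f} = {f \<in> edges Q. edges_adjacent e f}"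
    by (auto simp: edges_adjacent_def)
  have "{v \<in> verts Q. v \<in> e} = e"
    using simple_graph_edgeD(1)[OF Q e] by auto
  then have minus: "int (card {v \<in> verts Q. v \<notin> e}) = int (card (verts Q)) - 2"
    using card_Collect_not[OF finite_verts[OF Q]] simple_graph_edgeD(2)[OF Q e] by simp
  show ?thesis
    by (simp add: degree_trans_graph_ECopy[OF assms] plus minus card_adjacent_edges[OF Q e]
        card_nonadjacent_edges[OF Q e] algebra_simps split: sign.split)
qed

section \<open>Sums over the copies and of squared degrees\<close>

lemma sum_trans_verts:
  assumes "simple_graph Q"
  shows "sum w (trans_verts Q r s)
    = (\<Sum>g=1..r. \<Sum>v\<in>verts Q. w (VCopy g v)) + (\<Sum>h=1..s. \<Sum>e\<in>edges Q. w (ECopy h e))"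
proof -
  let ?A = "case_prod VCopy ` ({1..r} \<times> verts Q)" and ?B = "case_prod ECopy ` ({1..s} \<times> edges Q)"
  have "trans_verts Q r s = ?A \<union> ?B"
    by (auto simp: trans_verts_def)
  moreover have "sum w (?A \<union> ?B) = sum w ?A + sum w ?B"
    using finite_verts[OF assms] finite_edges[OF assms] by (intro sum.union_disjoint) auto
  moreover have "sum w ?A = (\<Sum>g=1..r. \<Sum>v\<in>verts Q. w (VCopy g v))"
    by (subst sum.reindex) (auto simp: inj_on_def sum.cartesian_product intro!: sum.cong)
  moreover have "sum w ?B = (\<Sum>h=1..s. \<Sum>e\<in>edges Q. w (ECopy h e))"
    by (subst sum.reindex) (auto simp: inj_on_def sum.cartesian_product intro!: sum.cong)
  ultimately show ?thesis by simp
qed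

text \<open>The contribution of a copy depends only on its sign, so it suffices to count the
  \<open>p\<close> positive and \<open>r - p\<close> negative entries.\<close>

lemma sum_plus_upto:
  fixes a b :: int
  assumes "p \<le> r"
  shows "(\<Sum>g=1..r. case plus_upto p g of Plus \<Rightarrow> a | Minus \<Rightarrow> b) = int p * a + (int r - int p) * b"
proof -
  have "{1..r} = {1..p} \<union> {p<..r}" using assms by auto
  then have "(\<Sum>g=1..r. case plus_upto p g of Plus \<Rightarrow> a | Minus \<Rightarrow> b)
      = (\<Sum>g=1..p. case plus_upto p g of Plus \<Rightarrow> a | Minus \<Rightarrow> b)
        + (\<Sum>g\<in>{p<..r}. case plus_upto p g of Plus \<Rightarrow> a | Minus \<Rightarrow> b)"
    by (simp only:) (rule sum.union_disjoint, auto)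
  also have "\<dots> = int p * a + (int r - int p) * b"
    using assms by (simp add: plus_upto_def of_nat_diff)
  finally show ?thesis .
qed

text \<open>All four degree formulas are affine in \<open>d(v)\<close> or \<open>D\<close>;
  expanding the square reduces each sum to a cardinality, a sum and a sum of squares.\<close>

lemma sum_affine_squared:
  fixes c k :: int
  shows "(\<Sum>i\<in>A. (c + k * f i)\<^sup>2)
    = int (card A) * c\<^sup>2 + 2 * c * k * (\<Sum>i\<in>A. f i) + k\<^sup>2 * (\<Sum>i\<in>A. (f i)\<^sup>2)"
proof -
  have "(c + k * f i)\<^sup>2 = c\<^sup>2 + 2 * c * k * f i + k\<^sup>2 * (f i)\<^sup>2" for i
    by (simp add: power2_sum power_mult_distrib)
  then show ?thesis
    by (simp add: sum.distrib flip: sum_distrib_left)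
qed

theorem theorem3:
  fixes Q :: "'a graph" and n m r s p q :: nat
  assumes "simple_graph Q" and "connected_graph Q"
    and "card (verts Q) = n" and "card (edges Q) = m"
    and "r \<ge> 1" and "s \<ge> 1"
    and "1 \<le> p" and "p \<le> r" and "1 \<le> q" and "q \<le> s"
  shows "first_zagreb (trans_graph Q r s (plus_upto p) (plus_upto q) (\<lambda>g h. Minus)) =
    (int p * (1 - int s)^2 + (int r - int p) * (int s + 1)^2
       + 2 * int q * (int n * int r - 2 * int r - 2)
       + 2 * (int q - int s) * (int m + int r * (int n - 2) + 1)) * first_zagreb Q
    + 2 * int s * second_zagreb Q + int s * forgotten_index Q
    + (int r - int p) * (int n * (int n + int s * int m - 1)^2
       - 4 * int m * (int n + int s * int m - 1) * (int s + 1))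
    + int p * int s * (int m)^2 * (int n * int s + 4 * (1 - int s))
    + int m * int q * (int n * int r - 2 * int r - 2)^2
    + int m * (int s - int q) * (int m + int r * (int n - 2) + 1)^2"
proof -
  note Q = \<open>simple_graph Q\<close>
  let ?T = "trans_graph Q r s (plus_upto p) (plus_upto q) (\<lambda>g h. Minus)"
  let ?d = "\<lambda>v. int (degree Q v)" and ?D = "\<lambda>e. \<Sum>v\<in>e. int (degree Q v)"
  \<comment> \<open>Constant terms of the degrees in negative vertex copies, positive edge copies
    and negative edge copies; left folded, they act as atoms in the final algebra.\<close>
  define a where "a = int n + int s * int m - 1"
  define b where "b = int n * int r - 2 * int r - 2"
  define c where "c = int m + int r * (int n - 2) + 1"
  note sums = sum_degree[OF Q] sum_edge_degree_sum[OF Q] sum_edge_degree_sum_squared[OF Q]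
    first_zagreb_def[of Q, symmetric] assms(3,4)
  \<comment> \<open>Here and in \<open>dE\<close> the coefficients, even \<open>1\<close> and
    \<open>- 1\<close>, are written out to match \<open>c + k * f i\<close> in
    \<open>sum_affine_squared\<close>.\<close>
  have dV: "(\<Sum>v\<in>verts Q. (int (degree ?T (VCopy g v)))\<^sup>2)
      = (case plus_upto p g of
          Plus \<Rightarrow> \<Sum>v\<in>verts Q. (int s * int m + (1 - int s) * ?d v)\<^sup>2
        | Minus \<Rightarrow> \<Sum>v\<in>verts Q. (a + (- (int s + 1)) * ?d v)\<^sup>2)" if "g \<in> {1..r}" for g
    using that assms(3,4)
    by (cases "plus_upto p g") (simp_all add: degree_VCopy_Minus[OF Q] a_def algebra_simps)
  have dE: "(\<Sum>e\<in>edges Q. (int (degree ?T (ECopy h e)))\<^sup>2)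
      = (case plus_upto q h of
          Plus \<Rightarrow> \<Sum>e\<in>edges Q. (b + 1 * ?D e)\<^sup>2
        | Minus \<Rightarrow> \<Sum>e\<in>edges Q. (c + (- 1) * ?D e)\<^sup>2)" if "h \<in> {1..s}" for h
    using that assms(3,4)
    by (cases "plus_upto q h") (simp_all add: degree_ECopy_Minus[OF Q] b_def c_def add.commute)
  have "first_zagreb ?T = (\<Sum>g=1..r. \<Sum>v\<in>verts Q. (int (degree ?T (VCopy g v)))\<^sup>2)
      + (\<Sum>h=1..s. \<Sum>e\<in>edges Q. (int (degree ?T (ECopy h e)))\<^sup>2)"
    unfolding first_zagreb_def
    by (subst sum_trans_verts[OF Q, symmetric]) (simp add: verts_trans_graph)
  also have "\<dots> =
      int p * (\<Sum>v\<in>verts Q. (int s * int m + (1 - int s) * ?d v)\<^sup>2)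
      + (int r - int p) * (\<Sum>v\<in>verts Q. (a + (- (int s + 1)) * ?d v)\<^sup>2)
      + (int q * (\<Sum>e\<in>edges Q. (b + 1 * ?D e)\<^sup>2)
      + (int s - int q) * (\<Sum>e\<in>edges Q. (c + (- 1) * ?D e)\<^sup>2))"
    \<comment> \<open>The congruence rule supplies the index ranges that \<open>dV\<close> and
      \<open>dE\<close> assume.\<close>
    by (simp only: dV dE sum_plus_upto[OF \<open>p \<le> r\<close>] sum_plus_upto[OF \<open>q \<le> s\<close>] cong: sum.cong)
  also have "\<dots> = int p * (int n * (int s * int m)\<^sup>2 + 2 * (int s * int m) * (1 - int s) * (2 * int m)
        + (1 - int s)\<^sup>2 * first_zagreb Q)
      + (int r - int p) * (int n * a\<^sup>2 + 2 * a * (- (int s + 1)) * (2 * int m)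
        + (- (int s + 1))\<^sup>2 * first_zagreb Q)
      + (int q * (int m * b\<^sup>2 + 2 * b * 1 * first_zagreb Q
        + 1\<^sup>2 * (forgotten_index Q + 2 * second_zagreb Q))
      + (int s - int q) * (int m * c\<^sup>2 + 2 * c * (- 1) * first_zagreb Q
        + (- 1)\<^sup>2 * (forgotten_index Q + 2 * second_zagreb Q)))"
    unfolding sum_affine_squared sums ..
  \<comment> \<open>The edge copies contribute
    \<open>forgotten_index Q + 2 * second_zagreb Q\<close> with total weight
    \<open>q + (s - q) = s\<close>; the cross term of the negative ones gives the factor
    \<open>q - s\<close>.\<close>
  also have "\<dots> = (int p * (1 - int s)\<^sup>2 + (int r - int p) * (int s + 1)\<^sup>2
        + 2 * int q * b + 2 * (int q - int s) * c) * first_zagreb Q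
      + 2 * int s * second_zagreb Q + int s * forgotten_index Q
      + (int r - int p) * (int n * a\<^sup>2 - 4 * int m * a * (int s + 1))
      + int p * int s * (int m)\<^sup>2 * (int n * int s + 4 * (1 - int s))
      + int m * int q * b\<^sup>2 + int m * (int s - int q) * c\<^sup>2"
    by (simp add: power2_eq_square algebra_simps)
  finally show ?thesis
    unfolding a_def b_def c_def .
qed

end
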